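(* The space $C_k(\mathbb{N}^{\mathbb{N}})$ has the Pytkeev property.
   Context: $\mathbb{N}^{\mathbb{N}}$ carries the product topology, with $\mathbb{N}$ discrete. For a topological space $X$, $C_k(X)$ is the set of all continuous real-valued functions on $X$ endowed with the compact-open topology; it is a topological group under pointwise addition. A local base at the constant zero function $\mathbf{0}$ is given by the sets $\{f\in C_k(X) : |f(x)|<1/n \text{ for all } x\in K\}$, where $K$ ranges over the compact subsets of $X$ and $n$ over the positive integers. $C_k(X)$ has the Pytkeev property if for each $A\subseteq C_k(X)$ with $\mathbf{0}\in\overline{A}\setminus A$, there are infinite sets $A_1,A_2,\dots\subseteq A$ such that each neighborhood of $\mathbf{0}$ contains some $A_n$ as a subset. *)

theory Defs
  imports "HOL-Analysis.Analysis"
begin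

text \<open>The case \<open>K = {}\<close> puts the whole set of continuous functions into the subbase,
  so that set is the underlying set of the space.\<close>

definition C_k :: "('a::topological_space \<Rightarrow> real) topology" where
  "C_k = topology_generated_by
     {{f. continuous_on UNIV f \<and> f ` K \<subseteq> U} | K U. compact K \<and> open U}"

lemma topspace_C_k: "topspace C_k = {f. continuous_on UNIV f}"
  unfolding C_k_def topology_generated_by_topspace by blast

text \<open>As \<open>C_k\<close> is a topological group, the property is stated at the zero function only.
  A neighborhood is any set with the point in its interior; it need not be open.\<close>

definition pytkeev_property :: "('a \<Rightarrow> real) topology \<Rightarrow> bool" where
  "pytkeev_property T \<longleftrightarrow>
     (\<forall>A. A \<subseteq> topspace T \<and> (\<lambda>_. 0) \<in> (T closure_of A) - A \<longrightarrow>
        (\<exists>B :: nat \<Rightarrow> ('a \<Rightarrow> real) set.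
           (\<forall>n. infinite (B n) \<and> B n \<subseteq> A) \<and>
           (\<forall>N. N \<subseteq> topspace T \<and> (\<lambda>_. 0) \<in> T interior_of N \<longrightarrow> (\<exists>n. B n \<subseteq> N))))"

end

theory Submission
  imports Defs
begin

text \<open>
  Let \<open>K f = {x. x \<le> f}\<close>; these compact sets are cofinal among the compact sets of the Baire space.
  For a finite sequence \<open>t\<close> let \<open>P t\<close> be the set of all \<open>x\<close> bounded by \<open>t\<close> on the domain of \<open>t\<close>.
  Every continuous function that is less than \<open>\<epsilon>\<close> in absolute value on \<open>K f\<close> is so on some
  \<open>P (f|n)\<close>. If \<open>0\<close> lies in the closure of \<open>A\<close> but not in \<open>A\<close>, then for each \<open>f\<close> and \<open>\<epsilon>\<close> there is
  an \<open>n\<close> such that infinitely many members of \<open>A\<close> are less than \<open>\<epsilon>\<close> on \<open>P (f|n)\<close>. Otherwise only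
  finitely many members enter at each stage \<open>n\<close>. A member that enters at stage \<open>n + 1\<close> has
  absolute value at least \<open>\<epsilon>\<close> somewhere on \<open>P (f|n)\<close>, and a member that enters at stage \<open>0\<close> is
  nonzero somewhere. These witness points all lie in one compact \<open>K g\<close>, which separates \<open>0\<close>
  from \<open>A\<close>. The countably many sets of members of \<open>A\<close> that are small on some \<open>P t\<close> thus do the job.
\<close>

lemma continuous_on_coordinate:
  "continuous_on S (\<lambda>x :: 'a \<Rightarrow> 'b::topological_space. x i)"
  by (rule continuous_on_subset[OF continuous_on_product_coordinates subset_UNIV])

text \<open>A product of finite sets, so Tychonoff's theorem applies.\<close>

lemma compact_le_fun: "compact {x :: 'a \<Rightarrow> nat. \<forall>i. x i \<le> f i}"
proof -
  have "{x. \<forall>i. x i \<le> f i} = (\<Pi>\<^sub>E i\<in>UNIV. {..f i})"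
    by auto
  moreover have "compactin (product_topology (\<lambda>_. euclidean) UNIV) (\<Pi>\<^sub>E i\<in>UNIV. {..f i})"
    by (simp add: compactin_PiE finite_imp_compact)
  ultimately show ?thesis
    by (simp add: euclidean_product_topology)
qed

lemma compact_nat_imp_finite:
  fixes S :: "nat set"
  assumes "compact S"
  shows "finite S"
proof -
  obtain F where "finite F" "S \<subseteq> (\<Union>x\<in>F. {x})"
    by (rule compactE_image[OF assms, of S "\<lambda>x. {x}"]) (auto simp: open_discrete)
  then show ?thesis
    by (auto intro: finite_subset)
qed

lemma compact_imp_le_fun:
  fixes K :: "('a \<Rightarrow> nat) set"
  assumes "compact K"
  obtains f where "K \<subseteq> {x. \<forall>i. x i \<le> f i}"
proof (rule that[of "\<lambda>i. Max ((\<lambda>x. x i) ` K)"])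
  have "finite ((\<lambda>x. x i) ` K)" for i
    by (rule compact_nat_imp_finite[OF
        compact_continuous_image[OF continuous_on_coordinate assms]])
  then show "K \<subseteq> {x. \<forall>i. x i \<le> Max ((\<lambda>x. x i) ` K)}"
    by (auto intro: Max_ge)
qed

lemma open_ex_coordinate_greater: "open {x :: nat \<Rightarrow> nat. \<exists>i<n. f i < x i}"
proof -
  have "open ((\<lambda>x. x i) -` {f i<..})" for i
    by (intro open_vimage continuous_on_coordinate) simp
  then have "open (\<Union>i<n. (\<lambda>x. x i) -` {f i<..})"
    by blast
  moreover have "(\<Union>i<n. (\<lambda>x. x i) -` {f i<..}) = {x. \<exists>i<n. f i < x i}"
    by auto
  ultimately show ?thesis
    by simp
qed

text \<open>If every \<open>n\<close> failed, the counterexamples \<open>x n\<close> would lie in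
  one compact set, and a finite subcover of a suitable increasing open cover would miss some
  \<open>x N\<close>.\<close>

lemma bound_on_le_fun_extends:
  fixes h :: "(nat \<Rightarrow> nat) \<Rightarrow> real"
  assumes h: "continuous_on UNIV h" and bound: "\<And>x. \<forall>i. x i \<le> f i \<Longrightarrow> \<bar>h x\<bar> < e"
  obtains n where "\<And>x. \<forall>i<n. x i \<le> f i \<Longrightarrow> \<bar>h x\<bar> < e"
proof (rule ccontr)
  assume "\<not> thesis"
  then have "\<exists>x. (\<forall>i<n. x i \<le> f i) \<and> \<not> \<bar>h x\<bar> < e" for n
    using that by blast
  then obtain x where x: "\<And>n i. i < n \<Longrightarrow> x n i \<le> f i" and e: "\<And>n. \<not> \<bar>h (x n)\<bar> < e"
    by metis
  \<comment> \<open>As \<open>x n\<close> is bounded by \<open>f\<close> below \<open>n\<close>,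
    only the finitely many \<open>x n\<close> with \<open>n \<le> i\<close> can exceed
    \<open>f i\<close> at coordinate \<open>i\<close>.\<close>
  define g where "g i = Max (insert (f i) ((\<lambda>n. x n i) ` {..i}))" for i
  have xg: "x n i \<le> g i" for n i
  proof (cases "i < n")
    case True
    then show ?thesis
      unfolding g_def by (intro order_trans[OF x[OF True]] Max_ge) auto
  next
    case False
    then show ?thesis
      unfolding g_def by (intro Max_ge) auto
  qed
  \<comment> \<open>\<open>V n\<close> increases with \<open>n\<close> and never contains
    \<open>x n\<close>.\<close>
  define V where "V n = {x. \<bar>h x\<bar> < e} \<union> {x. \<exists>i<n. f i < x i}" for n :: nat
  have "open (V n)" for n
    unfolding V_def
    by (intro open_Un open_ex_coordinate_greater open_Collect_less continuous_on_rabs h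
        continuous_on_const)
  moreover have "{x. \<forall>i. x i \<le> g i} \<subseteq> (\<Union>n\<in>UNIV. V n)"
  proof
    fix x
    show "x \<in> (\<Union>n\<in>UNIV. V n)"
    proof (cases "\<forall>i. x i \<le> f i")
      case True
      then show ?thesis
        unfolding V_def using bound by blast
    next
      case False
      then show ?thesis
        unfolding V_def by (auto simp: not_le)
    qed
  qed
  ultimately obtain F where F: "finite F" "{x. \<forall>i. x i \<le> g i} \<subseteq> (\<Union>n\<in>F. V n)"
    by (rule compactE_image[OF compact_le_fun])
  obtain N where N: "\<And>n. n \<in> F \<Longrightarrow> n \<le> N"
    using F(1) finite_nat_set_iff_bounded_le by auto
  obtain n where "n \<in> F" "x N \<in> V n"
    using F(2) xg by blast
  then obtain i where "i < N" "f i < x N i"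
    using e N unfolding V_def by (auto dest: order_less_le_trans)
  then show False
    using x by (simp add: leD)
qed

text \<open>Induction on the generation of the open sets: each subbasic set around zero contains
  some \<open>W f m\<close>, and the sets \<open>W f m\<close> are directed downwards.\<close>

lemma C_k_nhds_zero:
  fixes N :: "((nat \<Rightarrow> nat) \<Rightarrow> real) set"
  assumes "(\<lambda>_. 0) \<in> C_k interior_of N"
  obtains f m where
    "\<And>h. continuous_on UNIV h \<Longrightarrow> \<forall>x. (\<forall>i. x i \<le> f i) \<longrightarrow> \<bar>h x\<bar> < 1 / real (Suc m) \<Longrightarrow> h \<in> N"
proof -
  define W where "W f m = {h. continuous_on UNIV h \<and>
    (\<forall>x. (\<forall>i. x i \<le> f i) \<longrightarrow> \<bar>h x\<bar> < 1 / real (Suc m))}" for f :: "nat \<Rightarrow> nat" and m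
  have W_mono: "W f' m' \<subseteq> W f m" if "\<And>i. f i \<le> f' i" "m \<le> m'" for f f' m m'
  proof -
    have "1 / real (Suc m') \<le> 1 / real (Suc m)"
      using that(2) by (simp add: field_simps)
    moreover have "\<forall>i. x i \<le> f' i" if "\<forall>i. x i \<le> f i" for x
      using that \<open>\<And>i. f i \<le> f' i\<close> order_trans by blast
    ultimately show ?thesis
      unfolding W_def by (blast intro: order_less_le_trans)
  qed
  have "\<exists>f m. W f m \<subseteq> S"
    if "generate_topology_on {{f. continuous_on UNIV f \<and> f ` K \<subseteq> U} | K U. compact K \<and> open U} S"
      "(\<lambda>_. 0) \<in> S" for S :: "((nat \<Rightarrow> nat) \<Rightarrow> real) set"
    using that
  proof induction
    case Empty
    then show ?case by simp
  next
    case (Int S T)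
    then obtain f m f' m' where "W f m \<subseteq> S" "W f' m' \<subseteq> T"
      by auto
    then have "W (\<lambda>i. max (f i) (f' i)) (max m m') \<subseteq> S \<inter> T"
      using W_mono[of f "\<lambda>i. max (f i) (f' i)" m "max m m'"]
        W_mono[of f' "\<lambda>i. max (f i) (f' i)" m' "max m m'"] by auto
    then show ?case by (intro exI)
  next
    case (UN \<S>)
    obtain S where S: "S \<in> \<S>" "(\<lambda>_. 0) \<in> S"
      using UN.prems by (rule UnionE)
    then obtain f m where "W f m \<subseteq> S"
      using UN.IH by blast
    then have "W f m \<subseteq> \<Union>\<S>"
      by (rule order_trans[OF _ Union_upper[OF S(1)]])
    then show ?case by (intro exI)
  next
    case (Basis S)
    then obtain K :: "(nat \<Rightarrow> nat) set" and U :: "real set" where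
      S: "S = {f. continuous_on UNIV f \<and> f ` K \<subseteq> U}" "compact K" "open U"
      by blast
    obtain f where f: "K \<subseteq> {x. \<forall>i. x i \<le> f i}"
      using compact_imp_le_fun S(2) by blast
    show ?case
    \<comment> \<open>For empty \<open>K\<close> zero may lie outside \<open>U\<close>, but then
      \<open>S\<close> contains every continuous function.\<close>
    proof (cases "K = {}")
      case True
      then show ?thesis
        unfolding S(1) W_def by auto
    next
      case False
      then have "0 \<in> U"
        using Basis S(1) by auto
      then obtain e where e: "e > 0" "ball 0 e \<subseteq> U"
        using S(3) openE by blast
      then obtain m where m: "1 / real (Suc m) < e"
        using nat_approx_posE by blast
      have "h x \<in> U" if "h \<in> W f m" "x \<in> K" for h x
      proof -
        have "\<bar>h x\<bar> < 1 / real (Suc m)"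
          using that f unfolding W_def by blast
        then show ?thesis
          using e(2) m by (auto simp: dist_real_def)
      qed
      then have "W f m \<subseteq> S"
        unfolding S(1) by (auto simp: W_def)
      then show ?thesis by (intro exI)
    qed
  qed
  moreover obtain S where "openin C_k S" "(\<lambda>_. 0) \<in> S" "S \<subseteq> N"
    using assms by (auto simp: interior_of_def)
  ultimately obtain f m where "W f m \<subseteq> S"
    unfolding C_k_def openin_topology_generated_by_iff by presburger
  with \<open>S \<subseteq> N\<close> have "W f m \<subseteq> N"
    by (rule order_trans[rotated])
  then show thesis
    using that unfolding W_def by blast
qed

lemma C_k_zero_in_closure:
  assumes "(\<lambda>_. 0) \<in> C_k closure_of A" "compact K" "e > 0"
  obtains h where "h \<in> A" "continuous_on UNIV h" "\<And>x. x \<in> K \<Longrightarrow> \<bar>h x\<bar> < e"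
proof -
  define S where "S = {h. continuous_on UNIV h \<and> h ` K \<subseteq> {-e<..<e}}"
  have "openin C_k S"
    unfolding C_k_def S_def using assms(2) open_greaterThanLessThan
    by (intro topology_generated_by_Basis) blast
  moreover have "(\<lambda>_. 0) \<in> S"
    using assms(3) by (auto simp: S_def)
  ultimately obtain h where "h \<in> A" "h \<in> S"
    using assms(1) by (auto simp: in_closure_of)
  then show thesis
    by (intro that[of h]) (auto simp: S_def abs_less_iff image_subset_iff minus_less_iff)
qed

text \<open>Indexing by finite lists instead of functions leaves only countably many sets for each
  \<open>e\<close>.\<close>

definition small_on_prefix :: "nat list \<Rightarrow> real \<Rightarrow> ((nat \<Rightarrow> nat) \<Rightarrow> real) set" where
  "small_on_prefix t e = {h. \<forall>x. (\<forall>i<length t. x i \<le> t ! i) \<longrightarrow> \<bar>h x\<bar> < e}"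

lemma small_on_prefix_map:
  "h \<in> small_on_prefix (map f [0..<n]) e \<longleftrightarrow> (\<forall>x. (\<forall>i<n. x i \<le> f i) \<longrightarrow> \<bar>h x\<bar> < e)"
  by (simp add: small_on_prefix_def)

lemma infinite_small_on_prefix:
  assumes closure: "(\<lambda>_. 0) \<in> C_k closure_of A" and "(\<lambda>_. 0) \<notin> A" and "e > 0"
  obtains n where "infinite (A \<inter> small_on_prefix (map f [0..<n]) e)"
proof (rule ccontr)
  define D where "D n = small_on_prefix (map f [0..<n]) e" for n
  assume "\<not> thesis"
  then have fin: "finite (A \<inter> D n)" for n
    using that unfolding D_def by blast
  \<comment> \<open>One point serves all \<open>n\<close>: \<open>D\<close> is increasing, so at
    most one \<open>n\<close> satisfies both premises.\<close>
  have "\<exists>x. h x \<noteq> 0 \<and> (\<forall>n. h \<notin> D n \<longrightarrow> h \<in> D (Suc n) \<longrightarrow> (\<forall>i<n. x i \<le> f i) \<and> \<not> \<bar>h x\<bar> < e)"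
    if "h \<in> A" for h
  proof (cases "\<exists>n. h \<notin> D n \<and> h \<in> D (Suc n)")
    case True
    then obtain n where n: "h \<notin> D n" "h \<in> D (Suc n)"
      by blast
    have D_mono: "h \<in> D j" if "i \<le> j" "h \<in> D i" for i j
      using that unfolding D_def small_on_prefix_map by (meson order_less_le_trans)
    have "m = n" if "h \<notin> D m" "h \<in> D (Suc m)" for m
      using that n D_mono by (metis Suc_leI linorder_neqE_nat)
    moreover obtain x where "\<forall>i<n. x i \<le> f i" "\<not> \<bar>h x\<bar> < e"
      using n(1) unfolding D_def small_on_prefix_map by blast
    ultimately show ?thesis
      using \<open>e > 0\<close> by (metis abs_zero)
  next
    case False
    moreover have "h \<noteq> (\<lambda>_. 0)"
      using that assms(2) by blast
    ultimately show ?thesis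
      by metis
  qed
  then obtain w where w0: "\<And>h. h \<in> A \<Longrightarrow> h (w h) \<noteq> 0"
    and w: "\<And>h n i. h \<in> A \<Longrightarrow> h \<notin> D n \<Longrightarrow> h \<in> D (Suc n) \<Longrightarrow> i < n \<Longrightarrow> w h i \<le> f i"
    and we: "\<And>h n. h \<in> A \<Longrightarrow> h \<notin> D n \<Longrightarrow> h \<in> D (Suc n) \<Longrightarrow> \<not> \<bar>h (w h)\<bar> < e"
    by metis
  \<comment> \<open>A member entering at stage \<open>Suc j\<close> has its witness bounded by
    \<open>f\<close> below \<open>j\<close>. At coordinate \<open>i\<close> this leaves exactly the
    entry stages up to \<open>Suc i\<close> to be covered by the maximum.\<close>
  define g where "g i = Max (insert (f i) ((\<lambda>h. w h i) ` (A \<inter> (\<Union>n\<le>Suc i. D n))))" for i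
  have "finite (A \<inter> (\<Union>n\<le>Suc i. D n))" for i
    unfolding Int_UN_distrib using fin by (intro finite_UN_I finite_atMost)
  then have fin_g: "finite (insert (f i) ((\<lambda>h. w h i) ` (A \<inter> (\<Union>n\<le>Suc i. D n))))" for i
    by (intro finite.insertI finite_imageI)
  have fg: "f i \<le> g i" for i
    unfolding g_def by (rule Max_ge[OF fin_g]) simp
  have wg: "w h i \<le> g i" if "h \<in> A" "h \<in> D n" for h n i
  proof (cases "\<exists>n\<le>Suc i. h \<in> D n")
    case True
    then show ?thesis
      unfolding g_def using that(1) by (intro Max_ge[OF fin_g]) auto
  next
    case False
    define k where "k = (LEAST n. h \<in> D n)"
    have k: "h \<in> D k"
      unfolding k_def using that(2) by (rule LeastI)
    then have "Suc i < k"
      using False not_le by blast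
    then obtain j where j: "k = Suc j" "i < j"
      by (cases k) auto
    then have "h \<notin> D j"
      unfolding k_def by (metis lessI not_less_Least)
    then show ?thesis
      using w[OF that(1)] k j fg order_trans by metis
  qed
  \<comment> \<open>Members of \<open>D 0\<close> are below \<open>e\<close> everywhere, so their
    witness values need a smaller threshold; they are finitely many and nonzero, so it stays
    positive.\<close>
  define d where "d = Min (insert e ((\<lambda>h. \<bar>h (w h)\<bar>) ` (A \<inter> D 0)))"
  have "d > 0"
    unfolding d_def using fin w0 \<open>e > 0\<close> by (subst Min_gr_iff) auto
  have d: "d \<le> e" "\<And>h. h \<in> A \<Longrightarrow> h \<in> D 0 \<Longrightarrow> d \<le> \<bar>h (w h)\<bar>"
    unfolding d_def using fin by (auto intro!: Min_le)
  obtain h where h: "h \<in> A" "continuous_on UNIV h" "\<And>x. \<forall>i. x i \<le> g i \<Longrightarrow> \<bar>h x\<bar> < d"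
    by (rule C_k_zero_in_closure[OF closure compact_le_fun[of g] \<open>d > 0\<close>]) simp
  \<comment> \<open>\<open>wg\<close> applies to \<open>h\<close> only once \<open>h\<close> lies in
    some \<open>D n\<close>; smallness on the larger set given by \<open>g\<close> ensures
    this.\<close>
  have "\<bar>h x\<bar> < e" if "\<forall>i. x i \<le> f i" for x
    using h(3)[of x] that fg d(1) by (meson le_trans order_less_le_trans)
  then obtain n where "h \<in> D n"
    using bound_on_le_fun_extends[OF h(2)] unfolding D_def small_on_prefix_map by metis
  then have small: "\<bar>h (w h)\<bar> < d"
    using h(1,3) wg by blast
  show False
  proof (cases "h \<in> D 0")
    case True
    then show ?thesis
      using small d(2) h(1) by fastforce
  next
    case False
    then obtain k where "h \<notin> D k" "h \<in> D (Suc k)"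
      using \<open>h \<in> D n\<close> by (induction n) auto
    then show ?thesis
      using we[OF h(1)] small d(1) by fastforce
  qed
qed

theorem theorem1:
  shows "pytkeev_property (C_k :: ((nat \<Rightarrow> nat) \<Rightarrow> real) topology)"
  unfolding pytkeev_property_def
proof (intro allI impI, elim conjE)
  fix A :: "((nat \<Rightarrow> nat) \<Rightarrow> real) set"
  assume "A \<subseteq> topspace C_k" and "(\<lambda>_. 0) \<in> C_k closure_of A - A"
  then have A: "\<And>h. h \<in> A \<Longrightarrow> continuous_on UNIV h"
    and closure: "(\<lambda>_. 0) \<in> C_k closure_of A" "(\<lambda>_. 0) \<notin> A"
    by (auto simp: topspace_C_k)
  define E where "E p = A \<inter> small_on_prefix (fst p) (1 / real (Suc (snd p)))" for p
  \<comment> \<open>Every \<open>B n\<close> has to be infinite, so \<open>A\<close> itself replaces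
    the finite sets of the enumeration.\<close>
  define B where "B n = (if infinite (E (from_nat n)) then E (from_nat n) else A)" for n
  have E: "\<exists>n. infinite (E (map f [0..<n], m))" for f m
    using infinite_small_on_prefix[OF closure, of "1 / real (Suc m)" f]
    unfolding E_def by fastforce
  then have "infinite A"
    unfolding E_def by blast
  then have "\<forall>n. infinite (B n) \<and> B n \<subseteq> A"
    unfolding B_def E_def by auto
  moreover have "\<exists>n. B n \<subseteq> N" if "(\<lambda>_. 0) \<in> C_k interior_of N" for N
  proof -
    obtain f m where N: "\<And>h. continuous_on UNIV h \<Longrightarrow>
        \<forall>x. (\<forall>i. x i \<le> f i) \<longrightarrow> \<bar>h x\<bar> < 1 / real (Suc m) \<Longrightarrow> h \<in> N"
      using C_k_nhds_zero[OF \<open>(\<lambda>_. 0) \<in> C_k interior_of N\<close>] by blast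
    obtain n where n: "infinite (E (map f [0..<n], m))"
      using E by blast
    have "E (map f [0..<n], m) \<subseteq> N"
      using A N unfolding E_def by (auto simp: small_on_prefix_map)
    then have "B (to_nat (map f [0..<n], m)) \<subseteq> N"
      using n unfolding B_def by simp
    then show ?thesis ..
  qed
  ultimately show "\<exists>B :: nat \<Rightarrow> ((nat \<Rightarrow> nat) \<Rightarrow> real) set.
      (\<forall>n. infinite (B n) \<and> B n \<subseteq> A) \<and>
      (\<forall>N. N \<subseteq> topspace C_k \<and> (\<lambda>_. 0) \<in> C_k interior_of N \<longrightarrow> (\<exists>n. B n \<subseteq> N))"
    by blast
qed

end
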